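(* Let $h\in\mathbb{N}$ and let $w \in \mathcal{W}_h$. If $w$ is reducible, then its functional equivalence class $\mathfrak{F}[w]$ is piecewise linear path-connected.
   Context: For $h \in \mathbb{N}$ let $\mathcal{W}_h = \mathbb{R}^{3h+1}$, with elements (parameters) written $w = (a_1,b_1,c_1,\ldots,a_h,b_h,c_h,d)$, where $a_i,b_i,c_i,d\in\mathbb{R}$. Each $w\in\mathcal{W}_h$ defines $f_w:\mathbb{R}\to\mathbb{R}$ by $f_w(x) = d + \sum_{i=1}^h a_i\tanh(b_i x + c_i)$. The functional equivalence class of $w\in\mathcal{W}_h$ is $\mathfrak{F}[w]=\{w'\in\mathcal{W}_h \mid f_w=f_{w'}\}$. A parameter $w=(a_1,b_1,c_1,\ldots,a_h,b_h,c_h,d)\in\mathcal{W}_h$ is reducible if and only if it satisfies at least one of: (i) $a_i=0$ for some $i$; (ii) $b_i=0$ for some $i$; (iii) $(b_i,c_i)=(b_j,c_j)$ for some $i\neq j$; (iv) $(b_i,c_i)=(-b_j,-c_j)$ for some $i\ne j$. For $W\subseteq\mathcal{W}_h$, a piecewise linear path in $W$ is a continuous function $\rho:[0,1]\to W$ comprising a finite number of linear (affine) segments. The set $W$ is piecewise linear path-connected if for all $w,w'\in W$ there is a piecewise linear path $\rho$ in $W$ with $\rho(0)=w$ and $\rho(1)=w'$. *)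

theory Defs
  imports "HOL-Analysis.Analysis"
begin

(* The parameter space is the library's R^(3h+1), whose points are the functions
   nat => real that vanish from index 3h+1 on.  Hidden units are numbered from 0, and the
   coordinates come in the order (a_0, b_0, c_0, ..., a_(h-1), b_(h-1), c_(h-1), d). *)

type_synonym param = "nat \<Rightarrow> real"

abbreviation params :: "nat \<Rightarrow> param set" where
  "params h \<equiv> topspace (Euclidean_space (3 * h + 1))"

definition out_weight :: "param \<Rightarrow> nat \<Rightarrow> real" where
  "out_weight w i = w (3 * i)"

definition in_weight :: "param \<Rightarrow> nat \<Rightarrow> real" where
  "in_weight w i = w (3 * i + 1)"

definition in_bias :: "param \<Rightarrow> nat \<Rightarrow> real" where
  "in_bias w i = w (3 * i + 2)"

definition out_bias :: "nat \<Rightarrow> param \<Rightarrow> real" where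
  "out_bias h w = w (3 * h)"

definition net_fun :: "nat \<Rightarrow> param \<Rightarrow> real \<Rightarrow> real" where
  "net_fun h w x =
     out_bias h w + (\<Sum>i<h. out_weight w i * tanh (in_weight w i * x + in_bias w i))"

definition functional_class :: "nat \<Rightarrow> param \<Rightarrow> param set" where
  "functional_class h w = {w' \<in> params h. net_fun h w = net_fun h w'}"

definition reducible :: "nat \<Rightarrow> param \<Rightarrow> bool" where
  "reducible h w \<longleftrightarrow>
     (\<exists>i<h. out_weight w i = 0) \<or>
     (\<exists>i<h. in_weight w i = 0) \<or>
     (\<exists>i<h. \<exists>j<h. i \<noteq> j \<and>
        (in_weight w i, in_bias w i) = (in_weight w j, in_bias w j)) \<or>
     (\<exists>i<h. \<exists>j<h. i \<noteq> j \<and>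
        (in_weight w i, in_bias w i) = (- in_weight w j, - in_bias w j))"

definition affine_segment_on :: "real set \<Rightarrow> (real \<Rightarrow> param) \<Rightarrow> bool" where
  "affine_segment_on T \<rho> \<longleftrightarrow> (\<exists>p q. \<forall>t\<in>T. \<forall>k. \<rho> t k = p k + t * q k)"

definition piecewise_linear_path :: "nat \<Rightarrow> param set \<Rightarrow> (real \<Rightarrow> param) \<Rightarrow> bool" where
  "piecewise_linear_path h W \<rho> \<longleftrightarrow>
     pathin (subtopology (Euclidean_space (3 * h + 1)) W) \<rho> \<and>
     (\<exists>(m::nat) (s::nat \<Rightarrow> real). s 0 = 0 \<and> s m = 1 \<and>
        (\<forall>i<m. s i < s (Suc i) \<and> affine_segment_on {s i..s (Suc i)} \<rho>))"

(* Intended for W \<subseteq> params h. *)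
definition pl_path_connected :: "nat \<Rightarrow> param set \<Rightarrow> bool" where
  "pl_path_connected h W \<longleftrightarrow>
     (\<forall>w\<in>W. \<forall>w'\<in>W. \<exists>\<rho>. piecewise_linear_path h W \<rho> \<and> \<rho> 0 = w \<and> \<rho> 1 = w')"

end

(* Linear independence of tanh units of positive slope (up to sign) shows that all parameters of a
   functional class share the same reduced set of units, and reducibility means that this set has
   fewer than h elements. A parameter is joined to one that implements each reduced unit in exactly
   one slot by collapsing duplicate and constant units; two such parameters differ by a permutation
   and sign changes of slots, and these are carried out by segments through the unused slot. *)

theory Submission
  imports Defs "HOL-Complex_Analysis.Conformal_Mappings"
begin

subsection \<open>Linear independence of hyperbolic tangent units\<close>

text \<open>The zeros of \<open>cosh\<close> are the odd multiples of \<open>\<i> * pi / 2\<close>,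
  and the strip contains only the lowest of them above the real axis. This singles out the first
  pole of a tanh unit.\<close>

lemma cosh_zero_low_strip:
  assumes "cosh z = 0" "0 < Im z" "Im z \<le> pi / 2"
  shows "Re z = 0" "Im z = pi / 2"
proof -
  obtain n where n: "\<i> * z = complex_of_real (of_int n * pi) + of_real pi / 2"
    using assms(1) by (auto simp: cosh_conv_cos cos_eq_0)
  show "Re z = 0"
    using arg_cong[OF n, of Im] by simp
  have im: "- Im z = of_int n * pi + pi / 2"
    using arg_cong[OF n, of Re] by simp
  \<comment> \<open>The index is negative because multiplication by \<open>\<i>\<close> turns
    \<open>Im z\<close> into a negative real part.\<close>
  have "n = - 1"
  proof (rule ccontr)
    assume "n \<noteq> - 1"
    then consider "of_int n \<ge> (0::real)" | "of_int n \<le> (-2::real)"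
      by linarith
    then show False
    proof cases
      case 1
      then have "of_int n * pi \<ge> 0" by simp
      with im assms show False using pi_gt_zero by linarith
    next
      case 2
      then have "of_int n * pi \<le> -2 * pi" by (intro mult_right_mono) auto
      with im assms show False using pi_gt_zero by linarith
    qed
  qed
  with im show "Im z = pi / 2" by simp
qed

text \<open>
  Clearing the denominators \<open>cosh (b x + c)\<close> turns a linear relation into the vanishing of an
  entire function. At the pole of a unit of maximal slope \<open>b\<close>, all summands except the one of that
  unit vanish.
\<close>

lemma tanh_units_independent:
  fixes R :: "(real \<times> real) set"
  assumes fin: "finite R" and pos: "\<And>t. t \<in> R \<Longrightarrow> fst t > 0"
    and nz: "\<And>t. t \<in> R \<Longrightarrow> A t \<noteq> 0"
    and eq: "\<And>x. (\<Sum>t\<in>R. A t * tanh (fst t * x + snd t)) = K"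
  shows "R = {}"
proof (rule ccontr)
  assume "R \<noteq> {}"
  then have "Max (fst ` R) \<in> fst ` R" using fin by (intro Max_in) auto
  then obtain m where m: "m \<in> R" "fst m = Max (fst ` R)" by auto
  have le: "fst t \<le> fst m" if "t \<in> R" for t
    using that fin m(2) by auto
  define L where "L t z = complex_of_real (fst t) * z + complex_of_real (snd t)" for t z
  define F where "F z = (\<Sum>t\<in>R. complex_of_real (A t) * (sinh (L t z) * (\<Prod>s\<in>R - {t}. cosh (L s z))))
                        - complex_of_real K * (\<Prod>s\<in>R. cosh (L s z))" for z
  have hol: "F holomorphic_on UNIV"
    unfolding F_def L_def sinh_field_def cosh_field_def
    by (intro holomorphic_intros) auto
  have F_real: "F z = 0" if "z \<in> \<real>" for z
  proof -
    from that obtain x where x: "z = of_real x" by (auto elim: Reals_cases)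
    let ?l = "\<lambda>t. fst t * x + snd t"
    have "(\<Sum>t\<in>R. A t * (sinh (?l t) * (\<Prod>s\<in>R - {t}. cosh (?l s))))
          = (\<Sum>t\<in>R. A t * tanh (?l t) * (\<Prod>s\<in>R. cosh (?l s)))"
    proof (rule sum.cong)
      fix t assume "t \<in> R"
      then have "(\<Prod>s\<in>R. cosh (?l s)) = cosh (?l t) * (\<Prod>s\<in>R - {t}. cosh (?l s))"
        using fin by (simp add: prod.remove)
      then show "A t * (sinh (?l t) * (\<Prod>s\<in>R - {t}. cosh (?l s)))
          = A t * tanh (?l t) * (\<Prod>s\<in>R. cosh (?l s))"
        by (simp add: tanh_def)
    qed simp
    also have "\<dots> = K * (\<Prod>s\<in>R. cosh (?l s))"
      by (simp add: eq flip: sum_distrib_right)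
    finally have "complex_of_real (\<Sum>t\<in>R. A t * (sinh (?l t) * (\<Prod>s\<in>R - {t}. cosh (?l s))))
        = of_real (K * (\<Prod>s\<in>R. cosh (?l s)))" by (rule arg_cong)
    moreover have "sinh (L t z) = of_real (sinh (?l t))" "cosh (L t z) = of_real (cosh (?l t))" for t
      by (simp_all add: L_def x sinh_field_def cosh_field_def exp_of_real flip: of_real_mult of_real_add of_real_minus of_real_diff)
    ultimately show ?thesis
      by (simp add: F_def)
  qed
  \<comment> \<open>\<open>F\<close> vanishes on the real line, which accumulates at 0, so the
    identity theorem makes it vanish everywhere.\<close>
  have lim: "(0::complex) islimpt \<real>"
    unfolding islimpt_approachable
  proof (intro allI impI)
    fix e :: real assume "e > 0"
    then show "\<exists>z\<in>\<real>. z \<noteq> (0::complex) \<and> dist z 0 < e"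
      by (intro bexI[of _ "complex_of_real (e / 2)"]) (auto simp: norm_divide)
  qed
  have F0: "F z = 0" for z
    by (rule analytic_continuation[OF hol open_UNIV connected_UNIV subset_UNIV UNIV_I lim F_real UNIV_I])
  \<comment> \<open>The solution of \<open>L m z = \<i> * pi / 2\<close>: the pole of unit
    \<open>m\<close> in the upper half plane that is nearest to the real axis.\<close>
  define z0 where "z0 = (\<i> * of_real (pi / 2) - of_real (snd m)) / of_real (fst m)"
  have fm: "fst m > 0" using pos[OF m(1)] .
  have Lm: "L m z0 = \<i> * of_real (pi / 2)"
    using fm by (simp add: L_def z0_def)
  have cm: "cosh (L m z0) = 0"
    by (simp add: Lm cosh_conv_cos)
  have sm: "sinh (L m z0) \<noteq> 0"
    using cm sinh_square_eq[of "L m z0"] by auto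
  \<comment> \<open>Since the slope of \<open>m\<close> is maximal, \<open>Im (L s z0)\<close> lies
    in the strip up to \<open>pi / 2\<close>. A zero there forces first equal slopes, then equal
    biases, hence \<open>s = m\<close>.\<close>
  have other: "cosh (L s z0) \<noteq> 0" if "s \<in> R - {m}" for s
  proof
    assume c: "cosh (L s z0) = 0"
    have Ims: "Im (L s z0) = fst s / fst m * (pi / 2)"
      and Res: "Re (L s z0) = snd s - fst s * snd m / fst m"
      using fm by (simp_all add: L_def z0_def)
    have q: "0 < fst s / fst m" "fst s / fst m \<le> 1"
      using that pos le fm by auto
    have 1: "0 < Im (L s z0)" unfolding Ims by (intro mult_pos_pos q(1)) simp
    have 2: "Im (L s z0) \<le> pi / 2" unfolding Ims
      using mult_right_mono[OF q(2), of "pi / 2"] by simp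
    have "fst s / fst m * (pi / 2) = 1 * (pi / 2)"
      using cosh_zero_low_strip(2)[OF c 1 2] Ims by simp
    then have "fst s / fst m = 1" unfolding mult_cancel_right by simp
    then have "fst s = fst m" using fm by (simp add: field_simps)
    moreover from this have "snd s = snd m"
      using cosh_zero_low_strip(1)[OF c 1 2] Res fm by simp
    ultimately show False using that by (auto simp: prod_eq_iff)
  qed
  \<comment> \<open>For \<open>t\<close> other than \<open>m\<close> the product over
    \<open>R - {t}\<close> contains the vanishing factor \<open>cosh (L m z0)\<close>.\<close>
  have "(\<Sum>t\<in>R. complex_of_real (A t) * (sinh (L t z0) * (\<Prod>s\<in>R - {t}. cosh (L s z0))))
      = (\<Sum>t\<in>{m}. complex_of_real (A t) * (sinh (L t z0) * (\<Prod>s\<in>R - {t}. cosh (L s z0))))"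
    using fin m cm by (intro sum.mono_neutral_right) (auto intro!: exI[of _ m])
  moreover have "(\<Prod>s\<in>R. cosh (L s z0)) = 0" using m cm fin by auto
  ultimately have "complex_of_real (A m) * (sinh (L m z0) * (\<Prod>s\<in>R - {m}. cosh (L s z0))) = 0"
    using F0[of z0] by (simp add: F_def)
  then show False using nz[OF m(1)] sm other fin by auto
qed

subsection \<open>Normal form of the implemented function\<close>

text \<open>As tanh is odd, negating both entries of a unit only changes the sign of its value. This
  picks the representative of nonnegative slope; units of slope 0 are constant and stay as they
  are.\<close>

definition unit_upright :: "real \<times> real \<Rightarrow> real \<times> real" where
  "unit_upright t = (if fst t < 0 then (- fst t, - snd t) else t)"

definition unit_sign :: "real \<times> real \<Rightarrow> real" where
  "unit_sign t = (if fst t < 0 then - 1 else 1)"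

definition in_unit :: "param \<Rightarrow> nat \<Rightarrow> real \<times> real" where
  "in_unit w i = (in_weight w i, in_bias w i)"

text \<open>Indexing by the slope-bias pairs themselves keeps units distinct, and positive slopes
  exclude both constant units and mirrored duplicates.\<close>

definition normal_form ::
  "(real \<times> real) set \<Rightarrow> (real \<times> real \<Rightarrow> real) \<Rightarrow> real \<Rightarrow> (real \<Rightarrow> real) \<Rightarrow> bool" where
  "normal_form T A D f \<longleftrightarrow> finite T \<and> (\<forall>t\<in>T. 0 < fst t \<and> A t \<noteq> 0) \<and>
     (\<forall>x. f x = D + (\<Sum>t\<in>T. A t * tanh (fst t * x + snd t)))"

lemma tanh_in_unit:
  "tanh (in_weight w i * x + in_bias w i) = unit_sign (in_unit w i) *
     tanh (fst (unit_upright (in_unit w i)) * x + snd (unit_upright (in_unit w i)))"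
  using tanh_minus[of "in_weight w i * x + in_bias w i"]
  by (auto simp: in_unit_def unit_sign_def unit_upright_def)

lemma reducible_superfluous_unit:
  assumes "reducible h w"
    and A: "\<And>t. A t = (\<Sum>i | i < h \<and> unit_upright (in_unit w i) = t. out_weight w i * unit_sign (in_unit w i))"
    and T: "T = {t \<in> (\<lambda>i. unit_upright (in_unit w i)) ` {..<h}. 0 < fst t \<and> A t \<noteq> 0}"
  shows "\<exists>i<h. T \<subseteq> (\<lambda>i. unit_upright (in_unit w i)) ` ({..<h} - {i})"
proof -
  let ?u = "\<lambda>i. unit_upright (in_unit w i)"
  have dropI: "\<exists>i<h. T \<subseteq> ?u ` ({..<h} - {i})"
    if i: "i < h" "?u i \<notin> T \<or> (\<exists>j<h. j \<noteq> i \<and> ?u j = ?u i)" for i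
  proof (intro exI[of _ i] conjI subsetI)
    fix t assume "t \<in> T"
    then obtain k where k: "k < h" "t = ?u k" using T by auto
    show "t \<in> ?u ` ({..<h} - {i})"
    proof (cases "k = i")
      case True
      then obtain j where "j < h" "j \<noteq> i" "?u j = ?u i" using i \<open>t \<in> T\<close> k by auto
      then show ?thesis using k True by (auto intro!: image_eqI[of _ _ j])
    qed (use k in auto)
  qed (use i in auto)
  from \<open>reducible h w\<close> consider
      (out) i where "i < h" "out_weight w i = 0"
    | ("in") i where "i < h" "in_weight w i = 0"
    | (eq) i j where "i < h" "j < h" "i \<noteq> j" "in_unit w i = in_unit w j"
    | (neg) i j where "i < h" "j < h" "i \<noteq> j" "in_weight w i = - in_weight w j"
        "in_bias w i = - in_bias w j" "in_weight w i \<noteq> 0"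
    unfolding reducible_def in_unit_def by fastforce
  then show ?thesis
  proof cases
    case out
    show ?thesis
    proof (cases "\<exists>j<h. j \<noteq> i \<and> ?u j = ?u i")
      \<comment> \<open>With no partner, the zero output weight is the whole coefficient of this
        unit, so the unit is not in \<open>T\<close>.\<close>
      case False
      then have "{k. k < h \<and> ?u k = ?u i} = {i}" using out by auto
      then have "A (?u i) = 0" using out by (simp add: A)
      then show ?thesis using out T by (intro dropI[of i]) auto
    qed (use out dropI in blast)
  next
    case "in"
    then have "?u i \<notin> T" by (auto simp: T unit_upright_def in_unit_def)
    then show ?thesis using "in" dropI by blast
  next
    case eq
    then show ?thesis by (intro dropI[of i]) auto
  next
    \<comment> \<open>The nonzero slope matters: \<open>unit_upright\<close> would not flip a unit
      of slope 0. Zero slopes belong to the case \<open>in\<close>.\<close>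
    case neg
    then have "?u j = ?u i" by (auto simp: unit_upright_def in_unit_def)
    then show ?thesis using neg by (intro dropI[of i]) auto
  qed
qed

text \<open>Slots are grouped by upright unit and their signed output weights added. Units that
  cancel or have slope 0 contribute constants, which are absorbed into \<open>D\<close>.\<close>

lemma net_fun_normal_form:
  obtains T A D where "normal_form T A D (net_fun h w)"
    and "T \<subseteq> (\<lambda>i. unit_upright (in_unit w i)) ` {..<h}"
    and "reducible h w \<Longrightarrow> card T < h"
proof -
  define u where "u i = unit_upright (in_unit w i)" for i
  define A where "A t = (\<Sum>i | i < h \<and> u i = t. out_weight w i * unit_sign (in_unit w i))" for t
  define P where "P = u ` {..<h}"
  define T where "T = {t \<in> P. 0 < fst t \<and> A t \<noteq> 0}"
  \<comment> \<open>For a discarded \<open>t\<close> either the coefficient or the slope is 0, and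
    \<open>A t * tanh (snd t)\<close> is the right value in both cases.\<close>
  define D where "D = out_bias h w + (\<Sum>t\<in>P - T. A t * tanh (snd t))"
  have fin: "finite P" "T \<subseteq> P" by (auto simp: P_def T_def)
  have "net_fun h w x = D + (\<Sum>t\<in>T. A t * tanh (fst t * x + snd t))" for x
  proof -
    let ?th = "\<lambda>t. tanh (fst t * x + snd t)"
    have nonneg: "0 \<le> fst t" if "t \<in> P" for t
      using that by (auto simp: P_def u_def unit_upright_def)
    have "net_fun h w x
        = out_bias h w + (\<Sum>i<h. out_weight w i * unit_sign (in_unit w i) * ?th (u i))"
      by (simp add: net_fun_def tanh_in_unit u_def mult.assoc)
    also have "(\<Sum>i<h. out_weight w i * unit_sign (in_unit w i) * ?th (u i))
        = (\<Sum>t\<in>P. \<Sum>i | i \<in> {..<h} \<and> u i = t. out_weight w i * unit_sign (in_unit w i) * ?th (u i))"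
      using fin by (intro sum.group[symmetric]) (auto simp: P_def)
    also have "\<dots> = (\<Sum>t\<in>P. A t * ?th t)"
      by (auto simp: A_def sum_distrib_right intro!: sum.cong)
    also have "\<dots> = (\<Sum>t\<in>P - T. A t * ?th t) + (\<Sum>t\<in>T. A t * ?th t)"
      using fin by (intro sum.subset_diff) auto
    also have "(\<Sum>t\<in>P - T. A t * ?th t) = (\<Sum>t\<in>P - T. A t * tanh (snd t))"
    proof (intro sum.cong refl)
      fix t assume t: "t \<in> P - T"
      then have "A t = 0 \<or> fst t = 0" using nonneg[of t] by (auto simp: T_def)
      then show "A t * ?th t = A t * tanh (snd t)" by auto
    qed
    finally show ?thesis by (simp add: D_def)
  qed
  then have nf: "normal_form T A D (net_fun h w)"
    using finite_subset[OF fin(2,1)] by (auto simp: normal_form_def T_def)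
  moreover have "card T < h" if red: "reducible h w"
  proof -
    have "\<exists>i<h. T \<subseteq> (\<lambda>i. unit_upright (in_unit w i)) ` ({..<h} - {i})"
      by (rule reducible_superfluous_unit[OF red, of A]) (auto simp: A_def T_def P_def u_def)
    then obtain i where "i < h" "T \<subseteq> (\<lambda>i. unit_upright (in_unit w i)) ` ({..<h} - {i})"
      by blast
    then have "card T \<le> card ({..<h} - {i})"
      by (meson surj_card_le finite_Diff finite_lessThan)
    then show ?thesis using \<open>i < h\<close> by simp
  qed
  ultimately show thesis using that fin(2) unfolding P_def u_def by blast
qed

text \<open>Subtracting the two forms gives a linear relation with coefficients \<open>B\<close>,
  which independence forces to vanish. A unit in just one of the sets would have a nonzero
  \<open>B\<close>.\<close>

lemma normal_form_unique:
  assumes nf: "normal_form T A D f" and nf': "normal_form T' A' D' f"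
  shows "T = T'"
proof -
  let ?th = "\<lambda>x t. tanh (fst t * x + snd t)"
  define B where "B t = (if t \<in> T then A t else 0) - (if t \<in> T' then A' t else 0)" for t
  \<comment> \<open>The independence lemma asks for nonzero coefficients, so the vanishing ones are
    removed first.\<close>
  define R where "R = {t \<in> T \<union> T'. B t \<noteq> 0}"
  have fin: "finite T" "finite T'" using nf nf' by (auto simp: normal_form_def)
  have "(\<Sum>t\<in>R. B t * ?th x t) = D' - D" for x
  proof -
    have "(\<Sum>t\<in>R. B t * ?th x t) = (\<Sum>t\<in>T \<union> T'. B t * ?th x t)"
      using fin by (intro sum.mono_neutral_left) (auto simp: R_def)
    also have "\<dots> = (\<Sum>t\<in>T \<union> T'. if t \<in> T then A t * ?th x t else 0)
        - (\<Sum>t\<in>T \<union> T'. if t \<in> T' then A' t * ?th x t else 0)"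
      by (auto simp: B_def left_diff_distrib if_distrib sum_subtractf[symmetric] intro!: sum.cong)
    also have "(\<Sum>t\<in>T \<union> T'. if t \<in> T then A t * ?th x t else 0) = (\<Sum>t\<in>T. A t * ?th x t)"
      using fin by (intro sum.mono_neutral_cong_right) auto
    also have "(\<Sum>t\<in>T \<union> T'. if t \<in> T' then A' t * ?th x t else 0) = (\<Sum>t\<in>T'. A' t * ?th x t)"
      using fin by (intro sum.mono_neutral_cong_right) auto
    also have "(\<Sum>t\<in>T. A t * ?th x t) - (\<Sum>t\<in>T'. A' t * ?th x t) = D' - D"
    proof -
      have "f x = D + (\<Sum>t\<in>T. A t * ?th x t)" "f x = D' + (\<Sum>t\<in>T'. A' t * ?th x t)"
        using nf nf' by (simp_all only: normal_form_def)
      then show ?thesis by linarith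
    qed
    finally show ?thesis .
  qed
  then have R: "R = {}"
    using fin nf nf' by (intro tanh_units_independent[of R B]) (auto simp: R_def normal_form_def)
  then have B0: "B t = 0" if "t \<in> T \<union> T'" for t
    using that R unfolding R_def by blast
  show ?thesis
  proof (rule set_eqI)
    fix t
    show "t \<in> T \<longleftrightarrow> t \<in> T'"
      using B0[of t] nf nf' by (auto simp: B_def normal_form_def split: if_splits)
  qed
qed

subsection \<open>Straight moves within a functional class\<close>

definition net_of ::
  "nat \<Rightarrow> (nat \<Rightarrow> real) \<Rightarrow> (nat \<Rightarrow> real) \<Rightarrow> (nat \<Rightarrow> real) \<Rightarrow> real \<Rightarrow> param" where
  "net_of h a b c d k =
     (if k < 3 * h then
        (if k mod 3 = 0 then a (k div 3) else if k mod 3 = 1 then b (k div 3) else c (k div 3))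
      else if k = 3 * h then d else 0)"

lemma net_of_simps [simp]:
  "i < h \<Longrightarrow> out_weight (net_of h a b c d) i = a i"
  "i < h \<Longrightarrow> in_weight (net_of h a b c d) i = b i"
  "i < h \<Longrightarrow> in_bias (net_of h a b c d) i = c i"
  "out_bias h (net_of h a b c d) = d"
proof -
  have "(3 * i + 1) div 3 = i" "(3 * i + 1) mod 3 = 1" "(3 * i + 2) div 3 = i" "(3 * i + 2) mod 3 = 2"
    by presburger+
  then show "i < h \<Longrightarrow> out_weight (net_of h a b c d) i = a i"
    "i < h \<Longrightarrow> in_weight (net_of h a b c d) i = b i"
    "i < h \<Longrightarrow> in_bias (net_of h a b c d) i = c i"
    "out_bias h (net_of h a b c d) = d"
    by (simp_all only: out_weight_def in_weight_def in_bias_def out_bias_def net_of_def) auto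
qed

lemma net_of_params [simplified, simp]: "net_of h a b c d \<in> params h"
  by (auto simp: topspace_Euclidean_space net_of_def)

text \<open>In each slot either only the output weight varies, or the input side varies while the
  output weight stays 0. Both make the contribution of the slot affine along the segment.\<close>

definition straight_move :: "nat \<Rightarrow> param \<Rightarrow> param \<Rightarrow> param \<Rightarrow> bool" where
  "straight_move h w v v' \<longleftrightarrow> v \<in> functional_class h w \<and> v' \<in> functional_class h w \<and>
     (\<forall>i<h. in_weight v i = in_weight v' i \<and> in_bias v i = in_bias v' i \<or>
            out_weight v i = 0 \<and> out_weight v' i = 0)"

lemma straight_move_sym: "straight_move h w v v' \<Longrightarrow> straight_move h w v' v"
  by (auto simp: straight_move_def)

text \<open>The function at the interpolated parameter interpolates the functions at the two ends,
  and these coincide.\<close>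

lemma straight_move_segment:
  assumes "straight_move h w v v'"
  shows "(\<lambda>k. v k + t * (v' k - v k)) \<in> functional_class h w"
proof -
  let ?p = "\<lambda>k. v k + t * (v' k - v k)"
  have cl: "v \<in> functional_class h w" "v' \<in> functional_class h w"
    using assms by (auto simp: straight_move_def)
  have par: "?p \<in> params h"
    using cl by (auto simp: functional_class_def topspace_Euclidean_space)
  have "net_fun h ?p x = net_fun h w x" for x
  proof -
    let ?s = "\<lambda>v i. out_weight v i * tanh (in_weight v i * x + in_bias v i)"
    have "?s ?p i = ?s v i + t * (?s v' i - ?s v i)" if i: "i < h" for i
    proof -
      consider "in_weight v i = in_weight v' i \<and> in_bias v i = in_bias v' i"
        | "out_weight v i = 0 \<and> out_weight v' i = 0"
        using assms i by (auto simp: straight_move_def)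
      then show ?thesis
      proof cases
        case 1
        then have "in_weight ?p i = in_weight v i" "in_bias ?p i = in_bias v i"
          by (auto simp: in_weight_def in_bias_def)
        with 1 show ?thesis by (simp add: out_weight_def algebra_simps)
      next
        case 2
        then show ?thesis by (simp add: out_weight_def)
      qed
    qed
    then have "(\<Sum>i<h. ?s ?p i) = (\<Sum>i<h. ?s v i) + t * ((\<Sum>i<h. ?s v' i) - (\<Sum>i<h. ?s v i))"
      by (simp add: sum.distrib sum_subtractf flip: sum_distrib_left)
    then have "net_fun h ?p x = net_fun h v x + t * (net_fun h v' x - net_fun h v x)"
      by (simp add: net_fun_def out_bias_def algebra_simps)
    also have "\<dots> = net_fun h w x"
      using cl by (simp add: functional_class_def)
    finally show ?thesis .
  qed
  then show ?thesis using par by (auto simp: functional_class_def)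
qed

subsection \<open>Placements of the normal form in the available slots\<close>

text \<open>
  A placement sends each \<open>t \<in> T\<close> to the slot and the orientation of the unit that implements it.
\<close>

locale net_normal_form =
  fixes h :: nat and w :: param and T A D
  assumes nf: "normal_form T A D (net_fun h w)"
    and card_less: "card T < h"
begin

definition placement :: "(real \<times> real \<Rightarrow> nat \<times> real) \<Rightarrow> bool" where
  "placement g \<longleftrightarrow> inj_on (\<lambda>t. fst (g t)) T \<and>
     (\<forall>t\<in>T. fst (g t) < h \<and> (snd (g t) = 1 \<or> snd (g t) = - 1))"

text \<open>The input weights and biases of unoccupied slots are left free; this is the room in
  which a unit can be prepared before it is switched on.\<close>

definition realizes :: "param \<Rightarrow> (real \<times> real \<Rightarrow> nat \<times> real) \<Rightarrow> bool" where
  "realizes v g \<longleftrightarrow> v \<in> params h \<and> out_bias h v = D \<and>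
     (\<forall>t\<in>T. out_weight v (fst (g t)) = snd (g t) * A t \<and>
            in_weight v (fst (g t)) = snd (g t) * fst t \<and>
            in_bias v (fst (g t)) = snd (g t) * snd t) \<and>
     (\<forall>i<h. i \<notin> (\<lambda>t. fst (g t)) ` T \<longrightarrow> out_weight v i = 0)"

lemma finite_T: "finite T"
  using nf by (simp add: normal_form_def)

lemma realizes_class:
  assumes g: "placement g" and v: "realizes v g"
  shows "v \<in> functional_class h w"
proof -
  have "net_fun h v x = net_fun h w x" for x
  proof -
    let ?s = "\<lambda>i. out_weight v i * tanh (in_weight v i * x + in_bias v i)"
    have "(\<Sum>i<h. ?s i) = (\<Sum>i\<in>(\<lambda>t. fst (g t)) ` T. ?s i)"
      using g v by (intro sum.mono_neutral_right) (auto simp: placement_def realizes_def)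
    also have "\<dots> = (\<Sum>t\<in>T. ?s (fst (g t)))"
      using g by (simp add: placement_def sum.reindex)
    also have "\<dots> = (\<Sum>t\<in>T. A t * tanh (fst t * x + snd t))"
    proof (intro sum.cong refl)
      fix t assume t: "t \<in> T"
      then have "snd (g t) = 1 \<or> snd (g t) = - 1" using g by (auto simp: placement_def)
      then show "?s (fst (g t)) = A t * tanh (fst t * x + snd t)"
        using v t tanh_minus[of "fst t * x + snd t"] by (auto simp: realizes_def)
    qed
    finally show ?thesis
      using v nf by (simp add: net_fun_def realizes_def normal_form_def)
  qed
  then show ?thesis using v by (auto simp: functional_class_def realizes_def)
qed

text \<open>Occupied slots agree in both realizations and all other slots have output weight 0, so a
  single segment suffices.\<close>

lemma realizes_move:
  assumes g: "placement g" and v: "realizes v g" and v': "realizes v' g"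
  shows "straight_move h w v v'"
  unfolding straight_move_def
proof (intro conjI allI impI)
  fix i assume "i < h"
  show "in_weight v i = in_weight v' i \<and> in_bias v i = in_bias v' i \<or>
        out_weight v i = 0 \<and> out_weight v' i = 0"
  proof (cases "i \<in> (\<lambda>t. fst (g t)) ` T")
    case True
    then show ?thesis using v v' by (auto simp: realizes_def)
  next
    case False
    then show ?thesis using v v' \<open>i < h\<close> by (auto simp: realizes_def)
  qed
qed (use assms realizes_class in auto)

lemma placement_update:
  assumes g: "placement g" and "t \<in> T" and j: "j < h" "j \<notin> (\<lambda>t. fst (g t)) ` T"
    and e: "e = 1 \<or> e = - 1"
  shows "placement (g(t := (j, e)))"
proof -
  have "inj_on (\<lambda>s. fst ((g(t := (j, e))) s)) T"
    using g j(2) by (force simp: placement_def inj_on_def)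
  then show ?thesis using g j e by (auto simp: placement_def)
qed

text \<open>Two segments: \<open>?v1\<close> loads the unit into the silent slot \<open>j\<close>
  with orientation \<open>e\<close>, then \<open>?v2\<close> shifts the output weight from the old
  slot to \<open>j\<close> while all inputs stay fixed.\<close>

lemma move_to_free_slot:
  assumes g: "placement g" and v: "realizes v g"
    and t: "t \<in> T" and j: "j < h" "j \<notin> (\<lambda>t. fst (g t)) ` T"
    and e: "e = 1 \<or> e = - 1"
  obtains v' where "realizes v' (g(t := (j, e)))" "(straight_move h w)\<^sup>*\<^sup>* v v'"
proof -
  let ?b = "\<lambda>i. if i = j then e * fst t else in_weight v i"
  let ?c = "\<lambda>i. if i = j then e * snd t else in_bias v i"
  let ?a = "\<lambda>i. if i = j then e * A t else if i = fst (g t) then 0 else out_weight v i"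
  let ?v1 = "net_of h (out_weight v) ?b ?c D"
  let ?v2 = "net_of h ?a ?b ?c D"
  have slot: "fst (g s) < h" "fst (g s) \<noteq> j" if "s \<in> T" for s
    using g j that by (auto simp: placement_def)
  have inj: "fst (g s) \<noteq> fst (g t)" if "s \<in> T" "s \<noteq> t" for s
    using g t that by (auto simp: placement_def inj_on_def)
  have v1: "realizes ?v1 g"
    using v slot by (auto simp: realizes_def)
  have v2: "realizes ?v2 (g(t := (j, e)))"
    unfolding realizes_def
  proof (intro conjI ballI allI impI)
    fix i assume i: "i < h" "i \<notin> (\<lambda>s. fst ((g(t := (j, e))) s)) ` T"
    then have "i \<noteq> j" using t by force
    moreover have "out_weight v i = 0" if "i \<noteq> fst (g t)"
    proof -
      have "i \<notin> (\<lambda>t. fst (g t)) ` T"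
      proof
        assume "i \<in> (\<lambda>t. fst (g t)) ` T"
        then obtain s where "s \<in> T" "i = fst (g s)" by blast
        then have "i = fst ((g(t := (j, e))) s)" using that by auto
        with \<open>s \<in> T\<close> i(2) show False by blast
      qed
      then show ?thesis using v i(1) by (auto simp: realizes_def)
    qed
    ultimately show "out_weight ?v2 i = 0" using i(1) by simp
  qed (use v slot inj j in \<open>auto simp: realizes_def\<close>)
  have "straight_move h w v ?v1"
    using g v v1 by (rule realizes_move)
  moreover have "straight_move h w ?v1 ?v2"
    unfolding straight_move_def
    using realizes_class[OF g v1] realizes_class[OF placement_update[OF g t j e] v2] by simp
  ultimately show thesis using v2 that by (meson converse_rtranclp_into_rtranclp r_into_rtranclp)
qed

text \<open>Pigeonhole; this is where having fewer reduced units than slots enters.\<close>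

lemma free_slot: "\<exists>k<h. k \<notin> (\<lambda>t. fst (g t)) ` T"
proof (rule ccontr)
  assume "\<not> ?thesis"
  then have "{..<h} \<subseteq> (\<lambda>t. fst (g t)) ` T" by auto
  then have "card {..<h} \<le> card T" by (meson finite_T surj_card_le)
  then show False using card_less by simp
qed

text \<open>Induction on the number of misplaced units: the target slot of one of them is vacated if
  necessary, then that unit moves in, as in sorting with one spare cell.\<close>

lemma placements_connected:
  assumes g': "placement g'" and g: "placement g" and v: "realizes v g"
  shows "\<exists>v'. realizes v' g' \<and> (straight_move h w)\<^sup>*\<^sup>* v v'"
  using g v
proof (induction "card {t \<in> T. g t \<noteq> g' t}" arbitrary: g v rule: less_induct)
  case less
  note g = less.prems(1) and v = less.prems(2)
  show ?case
  proof (cases "{t \<in> T. g t \<noteq> g' t} = {}")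
    case True
    then have eq: "g t = g' t" if "t \<in> T" for t using that True by (metis (mono_tags, lifting) empty_iff mem_Collect_eq)
    then have "(\<lambda>t. fst (g t)) ` T = (\<lambda>t. fst (g' t)) ` T" by auto
    then have "realizes v g'" using v eq by (simp add: realizes_def)
    then show ?thesis by blast
  next
    case False
    then obtain t where t: "t \<in> T" "g t \<noteq> g' t" by auto
    let ?j = "fst (g' t)"
    have j: "?j < h" and e: "snd (g' t) = 1 \<or> snd (g' t) = - 1"
      using g' t by (auto simp: placement_def)
    obtain g1 v1 where g1: "placement g1" "realizes v1 g1" "?j \<notin> (\<lambda>t. fst (g1 t)) ` T"
      and sub: "{s \<in> T. g1 s \<noteq> g' s} \<subseteq> {s \<in> T. g s \<noteq> g' s}"
      and path: "(straight_move h w)\<^sup>*\<^sup>* v v1"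
    proof (cases "?j \<in> (\<lambda>t. fst (g t)) ` T")
      case True
      then obtain s where s: "s \<in> T" "fst (g s) = ?j" by auto
      \<comment> \<open>The occupant \<open>s\<close> is itself misplaced, either by injectivity of
        \<open>g'\<close> or because \<open>s = t\<close> sits in its slot with the wrong
        orientation. Evicting it therefore adds no misplaced unit.\<close>
      have wrong: "g s \<noteq> g' s"
        using g' s t by (cases "s = t") (auto simp: placement_def inj_on_def)
      obtain k where k: "k < h" "k \<notin> (\<lambda>t. fst (g t)) ` T" using free_slot by blast
      obtain v1 where "realizes v1 (g(s := (k, 1)))" "(straight_move h w)\<^sup>*\<^sup>* v v1"
        using move_to_free_slot[OF g v s(1) k, of 1] by auto
      moreover have "placement (g(s := (k, 1)))"
        using placement_update[OF g s(1) k] by simp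
      moreover have "?j \<notin> (\<lambda>t. fst ((g(s := (k, 1))) t)) ` T"
      proof
        assume "?j \<in> (\<lambda>t. fst ((g(s := (k, 1))) t)) ` T"
        then obtain r where r: "r \<in> T" "?j = fst ((g(s := (k, 1))) r)" by auto
        show False
        proof (cases "r = s")
          case True
          then have "k = fst (g s)" using r(2) s(2) by simp
          then show False using k(2) s(1) by blast
        next
          case False
          then show False using r s g by (auto simp: placement_def inj_on_def)
        qed
      qed
      moreover have "{r \<in> T. (g(s := (k, 1))) r \<noteq> g' r} \<subseteq> {r \<in> T. g r \<noteq> g' r}"
        using wrong by auto
      ultimately show thesis using that by blast
    qed (use g v that in blast)
    obtain v2 where v2: "realizes v2 (g1(t := g' t))" "(straight_move h w)\<^sup>*\<^sup>* v1 v2"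
      using move_to_free_slot[OF g1(1,2) t(1) j g1(3) e] by auto
    have g2: "placement (g1(t := g' t))"
      using placement_update[OF g1(1) t(1) j g1(3) e] by simp
    have "{s \<in> T. (g1(t := g' t)) s \<noteq> g' s} \<subset> {s \<in> T. g s \<noteq> g' s}"
      using sub t by auto
    then have "card {s \<in> T. (g1(t := g' t)) s \<noteq> g' s} < card {s \<in> T. g s \<noteq> g' s}"
      using finite_T by (intro psubset_card_mono) auto
    from less.hyps[OF this g2 v2(1)] show ?thesis
      using path v2(2) by (meson rtranclp_trans)
  qed
qed

text \<open>By uniqueness of the normal form every unit of \<open>T\<close> already sits, up to
  sign, in some slot of \<open>v\<close>. Choosing one such slot per unit and gathering the whole
  weight there changes no input, so it is one straight move.\<close>

lemma class_move_realizes: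
  assumes v: "v \<in> functional_class h w"
  obtains g v1 where "placement g" "realizes v1 g" "straight_move h w v v1"
proof -
  obtain T' A' D' where "normal_form T' A' D' (net_fun h v)"
      and T': "T' \<subseteq> (\<lambda>i. unit_upright (in_unit v i)) ` {..<h}"
    using net_fun_normal_form by metis
  then have "T' = T"
    using v nf normal_form_unique by (auto simp: functional_class_def)
  with T' have "\<forall>t\<in>T. \<exists>i<h. unit_upright (in_unit v i) = t" by (metis (no_types, lifting) imageE lessThan_iff subsetD)
  then obtain \<sigma> where \<sigma>: "\<And>t. t \<in> T \<Longrightarrow> \<sigma> t < h \<and> unit_upright (in_unit v (\<sigma> t)) = t"
    by metis
  define g where "g t = (\<sigma> t, unit_sign (in_unit v (\<sigma> t)))" for t
  have inj: "inj_on \<sigma> T" using \<sigma> by (metis inj_onI)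
  have g: "placement g"
    using inj \<sigma> by (auto simp: placement_def g_def unit_sign_def)
  \<comment> \<open>As \<open>\<sigma>\<close> is injective, at most one summand is nonzero: chosen
    slots get their signed coefficient, all others 0.\<close>
  define a where "a i = (\<Sum>t\<in>T. if \<sigma> t = i then unit_sign (in_unit v i) * A t else 0)" for i
  let ?v1 = "net_of h a (in_weight v) (in_bias v) D"
  have "a (\<sigma> t) = unit_sign (in_unit v (\<sigma> t)) * A t" if "t \<in> T" for t
  proof -
    have "a (\<sigma> t) = (\<Sum>s\<in>T. if s = t then unit_sign (in_unit v (\<sigma> t)) * A s else 0)"
      unfolding a_def using inj that by (intro sum.cong) (auto simp: inj_on_def)
    then show ?thesis using that finite_T by simp
  qed
  moreover have "in_weight v (\<sigma> t) = unit_sign (in_unit v (\<sigma> t)) * fst t \<and>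
      in_bias v (\<sigma> t) = unit_sign (in_unit v (\<sigma> t)) * snd t" if "t \<in> T" for t
    using \<sigma>[OF that] by (cases t) (auto simp: unit_upright_def unit_sign_def in_unit_def split: if_splits)
  moreover have "a i = 0" if "i \<notin> \<sigma> ` T" for i
    unfolding a_def using that by (intro sum.neutral) auto
  ultimately have v1: "realizes ?v1 g"
    using \<sigma> by (auto simp: realizes_def g_def)
  have "straight_move h w v ?v1"
    using v realizes_class[OF g v1] by (simp add: straight_move_def)
  with g v1 that show thesis by blast
qed

text \<open>Both ends collapse to realizations of placements; the first is rearranged to the
  placement of the second, and the second collapse is run backwards.\<close>

lemma class_connected:
  assumes "v \<in> functional_class h w" "v' \<in> functional_class h w"
  shows "(straight_move h w)\<^sup>*\<^sup>* v v'"
proof -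
  obtain g v1 where 1: "placement g" "realizes v1 g" "straight_move h w v v1"
    using class_move_realizes[OF assms(1)] .
  obtain g' v1' where 2: "placement g'" "realizes v1' g'" "straight_move h w v' v1'"
    using class_move_realizes[OF assms(2)] .
  obtain v2 where 3: "realizes v2 g'" "(straight_move h w)\<^sup>*\<^sup>* v1 v2"
    using placements_connected[OF 2(1) 1(1,2)] by blast
  have "straight_move h w v2 v1'"
    using realizes_move[OF 2(1) 3(1) 2(2)] .
  then show ?thesis
    using 1(3) 3(2) straight_move_sym[OF 2(3)]
    by (meson converse_rtranclp_into_rtranclp rtranclp.rtrancl_into_rtrancl)
qed

end

subsection \<open>From chains of segments to piecewise linear paths\<close>

text \<open>Spending one unit of time on each segment lets a new segment be appended without
  reparametrizing the earlier ones.\<close>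

lemma chain_polygonal:
  assumes "R\<^sup>*\<^sup>* v v'" and "v \<in> C"
    and seg: "\<And>p q t. R p q \<Longrightarrow> (\<lambda>k. p k + t * (q k - p k)) \<in> C"
  shows "\<exists>(m::nat) \<rho>. \<rho> 0 = v \<and> \<rho> (real m) = v' \<and>
    (\<forall>i<m. affine_segment_on {real i..real (Suc i)} \<rho>) \<and> (\<forall>t\<in>{0..real m}. \<rho> t \<in> C)"
  using assms(1)
proof induction
  case base
  show ?case using \<open>v \<in> C\<close> by (intro exI[of _ 0] exI[of _ "\<lambda>_. v"]) auto
next
  case (step p q)
  then obtain m \<rho> where \<rho>: "\<rho> 0 = v" "\<rho> (real m) = p"
    "\<And>i. i < m \<Longrightarrow> affine_segment_on {real i..real (Suc i)} \<rho>" "\<And>t. t \<in> {0..real m} \<Longrightarrow> \<rho> t \<in> C"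
    by blast
  define \<rho>' where "\<rho>' t = (if t \<le> real m then \<rho> t else (\<lambda>k. p k + (t - real m) * (q k - p k)))" for t
  have last: "\<rho>' t = (\<lambda>k. p k + (t - real m) * (q k - p k))" if "t \<ge> real m" for t
    using that \<rho>(2) by (cases "t = real m") (auto simp: \<rho>'_def)
  have "affine_segment_on {real i..real (Suc i)} \<rho>'" if "i < Suc m" for i
  proof (cases "i = m")
    case True
    have "\<rho>' t k = (p k - real m * (q k - p k)) + t * (q k - p k)" if "t \<ge> real m" for t k
      using last[OF that] by (simp add: algebra_simps)
    then show ?thesis unfolding affine_segment_on_def True
      by (intro exI[of _ "\<lambda>k. p k - real m * (q k - p k)"] exI[of _ "\<lambda>k. q k - p k"]) auto
  next
    case False
    then have "i < m" using that by simp
    then have "\<rho>' t = \<rho> t" if "t \<in> {real i..real (Suc i)}" for t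
      using that by (auto simp: \<rho>'_def)
    then show ?thesis using \<rho>(3)[OF \<open>i < m\<close>] by (simp add: affine_segment_on_def)
  qed
  moreover have "\<rho>' t \<in> C" if "t \<in> {0..real (Suc m)}" for t
    using that \<rho>(4) seg[OF step.hyps(2)] by (auto simp: \<rho>'_def)
  moreover have "\<rho>' 0 = v" "\<rho>' (real (Suc m)) = q"
    using \<rho>(1) last by (auto simp: \<rho>'_def)
  ultimately show ?case by blast
qed

lemma affine_segments_continuous:
  assumes "\<And>i. i < m \<Longrightarrow> affine_segment_on {s i..s (Suc i)} \<rho>"
    and "\<And>i. i < m \<Longrightarrow> s i \<le> s (Suc i)"
  shows "s 0 \<le> s m \<and> continuous_on {s 0..s m} (\<lambda>t. \<rho> t k)"
  using assms
proof (induction m)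
  case (Suc m)
  then have IH: "s 0 \<le> s m" "continuous_on {s 0..s m} (\<lambda>t. \<rho> t k)" and le: "s m \<le> s (Suc m)"
    by auto
  obtain p q where "\<forall>t\<in>{s m..s (Suc m)}. \<forall>k. \<rho> t k = p k + t * q k"
    using Suc.prems(1)[of m] by (auto simp: affine_segment_on_def)
  then have "continuous_on {s m..s (Suc m)} (\<lambda>t. \<rho> t k) \<longleftrightarrow>
      continuous_on {s m..s (Suc m)} (\<lambda>t. p k + t * q k)"
    by (intro continuous_on_cong) auto
  then have "continuous_on {s m..s (Suc m)} (\<lambda>t. \<rho> t k)"
    by (auto intro!: continuous_intros)
  then have "continuous_on ({s 0..s m} \<union> {s m..s (Suc m)}) (\<lambda>t. \<rho> t k)"
    using IH by (intro continuous_on_closed_Un) auto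
  then show ?case using IH le by (simp add: ivl_disj_un_two_touch)
qed auto

text \<open>\<open>Euclidean_space\<close> carries the topology of a subspace of a product, so
  continuity is checked coordinate by coordinate.\<close>

lemma piecewise_linear_pathI:
  fixes s :: "nat \<Rightarrow> real"
  assumes "W \<subseteq> params h" and s: "s 0 = 0" "s m = 1" "\<And>i. i < m \<Longrightarrow> s i < s (Suc i)"
    and aff: "\<And>i. i < m \<Longrightarrow> affine_segment_on {s i..s (Suc i)} \<rho>"
    and mem: "\<And>t. t \<in> {0..1} \<Longrightarrow> \<rho> t \<in> W"
  shows "piecewise_linear_path h W \<rho>"
proof -
  have "continuous_on {0..1} (\<lambda>t. \<rho> t k)" for k
    using affine_segments_continuous[of m s \<rho> k] s aff by (auto simp: less_imp_le)
  moreover have "\<rho> ` {0..1} \<subseteq> params h" using mem assms(1) by auto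
  ultimately have "pathin (subtopology (Euclidean_space (3 * h + 1)) W) \<rho>"
    using mem unfolding pathin_def continuous_map_in_subtopology Euclidean_space_def
    by (auto simp: continuous_map_componentwise_UNIV topspace_Euclidean_space[unfolded Euclidean_space_def] image_subset_iff Pi_iff)
  then show ?thesis using s aff unfolding piecewise_linear_path_def by blast
qed

lemma chain_piecewise_linear_path:
  assumes "R\<^sup>*\<^sup>* v v'" and v: "v \<in> W" and "W \<subseteq> params h"
    and seg: "\<And>p q t. R p q \<Longrightarrow> (\<lambda>k. p k + t * (q k - p k)) \<in> W"
  shows "\<exists>\<rho>. piecewise_linear_path h W \<rho> \<and> \<rho> 0 = v \<and> \<rho> 1 = v'"
proof -
  obtain m \<rho> where \<rho>: "\<rho> 0 = v" "\<rho> (real m) = v'"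
    "\<And>i. i < m \<Longrightarrow> affine_segment_on {real i..real (Suc i)} \<rho>" "\<And>t. t \<in> {0..real m} \<Longrightarrow> \<rho> t \<in> W"
    using chain_polygonal[OF assms(1) v seg] by blast
  show ?thesis
  proof (cases "m = 0")
    case True
    \<comment> \<open>An empty chain yields no subdivision of the unit interval, so a constant path
      with one segment is used.\<close>
    have "piecewise_linear_path h W (\<lambda>_. v)"
    proof (rule piecewise_linear_pathI[of _ _ real 1])
      show "affine_segment_on {real i..real (Suc i)} (\<lambda>_. v)" for i
        unfolding affine_segment_on_def by (intro exI[of _ v] exI[of _ "\<lambda>_. 0"]) simp
    qed (use assms(3) v in auto)
    then show ?thesis using \<rho>(1,2) True by auto
  next
    case False
    \<comment> \<open>Rescaling time by \<open>m\<close> takes the integer breakpoints to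
      \<open>i / m\<close>.\<close>
    have "piecewise_linear_path h W (\<lambda>t. \<rho> (real m * t))"
    proof (rule piecewise_linear_pathI[of _ _ "\<lambda>i. real i / real m" m])
      fix i assume "i < m"
      then obtain p q where pq: "\<forall>t\<in>{real i..real (Suc i)}. \<forall>k. \<rho> t k = p k + t * q k"
        using \<rho>(3) by (force simp: affine_segment_on_def)
      have "\<rho> (real m * t) k = p k + t * (real m * q k)"
        if "t \<in> {real i / real m..real (Suc i) / real m}" for t k
      proof -
        have "real m * t \<in> {real i..real (Suc i)}"
          using that False by (auto simp: field_simps)
        with pq show ?thesis by (simp only: mult_ac)
      qed
      then show "affine_segment_on {real i / real m..real (Suc i) / real m} (\<lambda>t. \<rho> (real m * t))"
        unfolding affine_segment_on_def by (intro exI[of _ p] exI[of _ "\<lambda>k. real m * q k"]) auto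
      show "real i / real m < real (Suc i) / real m"
        using False by (simp add: divide_strict_right_mono)
    next
      fix t :: real assume "t \<in> {0..1}"
      then show "\<rho> (real m * t) \<in> W" using \<rho>(4) by (simp add: mult_left_le)
    qed (use assms(3) False in auto)
    then show ?thesis using \<rho>(1,2) by (intro exI[of _ "\<lambda>t. \<rho> (real m * t)"]) auto
  qed
qed

theorem theorem6p1:
  fixes h :: nat and w :: param
  assumes "w \<in> params h"
    and "reducible h w"
  shows "pl_path_connected h (functional_class h w)"
  unfolding pl_path_connected_def
proof (intro ballI)
  fix v v' assume v: "v \<in> functional_class h w" and v': "v' \<in> functional_class h w"
  \<comment> \<open>Reducibility is used only here, to leave a spare slot for the
    rearrangements.\<close>
  obtain T A D where "normal_form T A D (net_fun h w)" "card T < h"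
    using net_fun_normal_form assms(2) by metis
  then interpret net_normal_form h w T A D
    by unfold_locales
  show "\<exists>\<rho>. piecewise_linear_path h (functional_class h w) \<rho> \<and> \<rho> 0 = v \<and> \<rho> 1 = v'"
  proof (rule chain_piecewise_linear_path)
    show "(straight_move h w)\<^sup>*\<^sup>* v v'" using v v' by (rule class_connected)
    show "functional_class h w \<subseteq> params h" by (auto simp: functional_class_def)
  qed (use v straight_move_segment in auto)
qed

end
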